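(* Let $\beta>0$, $\lambda>0$, $t_0\ge0$ and $y_{t_0}>0$. Let $y(t)$ be the non-negative solution of $$\begin{cases}y'(t)+\beta y^\lambda(t)=k(t)\ge0,\quad t>t_0,\\ y(t_0)=y_{t_0},\end{cases}$$ and let $y_1(t)$ be the solution of $$\begin{cases}y_1'(t)+\beta y_1^\lambda(t)=0,\quad t>t_0,\\ y_1(t_0)=y_{t_0}.\end{cases}$$ Then for any $t\ge t_0$, $$y(t)\ge y_1(t)=\begin{cases}y_{t_0}e^{-\beta(t-t_0)},&\text{if }\lambda=1,\\ y_{t_0}\left[1+(\lambda-1)\beta y_{t_0}^{\lambda-1}(t-t_0)\right]^{\frac1{1-\lambda}},&\text{if }\lambda\ne1.\end{cases}$$
   Context: Here $y$, $y_1$, $k$ are real-valued functions of $t\ge t_0$, and $y^\lambda(t)$ means $(y(t))^\lambda$.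
   Formalization: For λ<1 the bracket, which becomes negative for large t (for λ=1/2 the printed formula then grows and no longer solves the equation), is replaced by its positive part, and y_1 is taken to be non-negative, as y is, so that y_1^λ is meaningful. *)

theory Defs
  imports "HOL-Analysis.Analysis"
begin

(* Classical solutions on the whole half-line t >= t0 of
     y' + \<beta> y^lam = k  for t > t0,   y t0 = y0.
   Since the exponent lam > 0 is an arbitrary real, x^lam is only meaningful for x >= 0, so a
   solution takes non-negative values.  This matters for lam < 1: as powr is total, functions
   that become negative after reaching 0 could otherwise satisfy the equation as well.
   On x >= 0 powr is the usual power; in particular 0 powr lam = 0.
   Continuity at t0 links the initial value to the equation, which is imposed only for t > t0;
   no regularity of k is required. *)
definition nonneg_solution ::
  "real \<Rightarrow> real \<Rightarrow> real \<Rightarrow> real \<Rightarrow> (real \<Rightarrow> real) \<Rightarrow> (real \<Rightarrow> real) \<Rightarrow> bool" where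
  "nonneg_solution \<beta> lam t0 y0 k y \<longleftrightarrow>
     continuous_on {t0..} y \<and>
     (\<forall>t\<ge>t0. 0 \<le> y t) \<and>
     (\<forall>t>t0. y differentiable (at t) \<and> deriv y t + \<beta> * y t powr lam = k t) \<and>
     y t0 = y0"

(* The bracket [1 + (lam - 1) \<beta> y0^(lam-1) (t - t0)].  For lam > 1 it is at least 1 and the
   positive part has no effect.  For lam < 1 it reaches 0 at a finite time and is negative
   afterwards, where its real power has no meaning; the solution is then 0, which is what the
   positive part raised to the positive power 1 / (1 - lam) gives. *)
definition pos_bracket :: "real \<Rightarrow> real \<Rightarrow> real \<Rightarrow> real \<Rightarrow> real \<Rightarrow> real" where
  "pos_bracket \<beta> lam t0 y0 t = max 0 (1 + (lam - 1) * \<beta> * y0 powr (lam - 1) * (t - t0))"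

end

theory Submission imports Defs begin

text \<open>
  Everything rests on the fact that \<open>x \<mapsto> x powr lam\<close> is non-decreasing on \<open>x \<ge> 0\<close>.  If one solution
  exceeds another one that has the larger source term, then the gap between them has a non-positive
  derivative.  A gap that cannot grow while it is positive never becomes positive
  (\<open>nonpos_if_decreasing_where_pos\<close>), which gives the comparison \<open>nonneg_solution_mono\<close>.  Monotonicity
  takes the place of the Gronwall argument, which would break down for \<open>lam < 1\<close>: there
  \<open>x powr lam\<close> is not Lipschitz at \<open>0\<close>, and solutions do reach \<open>0\<close>.

  Applied in both directions, the comparison says that the initial value problem has at most one
  non-negative solution.  The closed formula for \<open>y1\<close> therefore follows once the right-hand side is
  known to solve the homogeneous problem.  The only delicate point there is the extinction time for
  \<open>lam < 1\<close>: the bracket is raised to a power \<open>1 / (1 - lam) > 1\<close>, and such a power of a positive part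
  is differentiable even where the bracket vanishes (\<open>has_real_derivative_pos_part_powr\<close>).
\<close>

text \<open>
  If \<open>d\<close> were positive at \<open>b\<close>, it would be positive from its last non-positive time \<open>s\<close> onwards,
  hence non-increasing on \<open>[s, b]\<close>, and so at most \<open>d s \<le> 0\<close> at \<open>b\<close>.
\<close>

lemma nonpos_if_decreasing_where_pos:
  fixes d d' :: "real \<Rightarrow> real"
  assumes "a \<le> b" and cont: "continuous_on {a..b} d" and "d a \<le> 0"
    and deriv: "\<And>t. a < t \<Longrightarrow> t < b \<Longrightarrow> (d has_real_derivative d' t) (at t)"
    and decr: "\<And>t. a < t \<Longrightarrow> t < b \<Longrightarrow> d t > 0 \<Longrightarrow> d' t \<le> 0"
  shows "d b \<le> 0"
proof (rule ccontr)
  assume "\<not> d b \<le> 0"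
  define S where "S = {t \<in> {a..b}. d t \<le> 0}"
  have "closed S"
    unfolding S_def by (intro continuous_on_closed_Collect_le cont continuous_intros)
  moreover have "bounded S"
    by (rule bounded_subset[of "{a..b}"]) (auto simp: S_def)
  ultimately have "compact S"
    by (simp add: compact_eq_bounded_closed)
  moreover have "a \<in> S"
    using assms by (simp add: S_def)
  ultimately obtain s where "s \<in> S" and last: "\<And>t. t \<in> S \<Longrightarrow> t \<le> s"
    using compact_attains_sup[of S] by blast
  then have s: "a \<le> s" "s < b" "d s \<le> 0"
    using \<open>\<not> d b \<le> 0\<close> by (auto simp: S_def order.order_iff_strict)
  have pos: "d t > 0" if "s < t" "t < b" for t
    using last[of t] that s by (force simp: S_def)
  have "d b \<le> d s"
  proof (rule DERIV_nonpos_imp_decreasing_open[of s b d])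
    show "\<exists>l. (d has_real_derivative l) (at t) \<and> l \<le> 0" if "s < t" "t < b" for t
      using deriv[of t] decr[of t] pos[OF that] that s by force
    show "continuous_on {s..b} d"
      by (rule continuous_on_subset[OF cont]) (use s in auto)
  qed (use s in auto)
  then show False
    using s \<open>\<not> d b \<le> 0\<close> by simp
qed

lemma nonneg_solution_has_derivative:
  assumes "nonneg_solution \<beta> lam t0 y0 k y" and "t > t0"
  shows "(y has_real_derivative k t - \<beta> * y t powr lam) (at t)"
proof -
  have "y differentiable (at t)" and "deriv y t = k t - \<beta> * y t powr lam"
    using assms by (auto simp: nonneg_solution_def algebra_simps)
  then show ?thesis
    by (metis DERIV_deriv_iff_real_differentiable)
qed

text \<open>
  Absorption is monotone in the solution: while \<open>u > v\<close>, the difference \<open>u - v\<close> loses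
  \<open>\<beta> * (u powr lam - v powr lam) \<ge> 0\<close> and gains at most \<open>f - g \<le> 0\<close>.
\<close>

lemma nonneg_solution_mono:
  assumes "\<beta> \<ge> 0" and "lam \<ge> 0"
    and u: "nonneg_solution \<beta> lam t0 u0 f u" and v: "nonneg_solution \<beta> lam t0 v0 g v"
    and "u0 \<le> v0" and fg: "\<And>t. t > t0 \<Longrightarrow> f t \<le> g t" and "t \<ge> t0"
  shows "u t \<le> v t"
proof -
  let ?d = "\<lambda>s. u s - v s"
  let ?d' = "\<lambda>s. (f s - \<beta> * u s powr lam) - (g s - \<beta> * v s powr lam)"
  have "?d t \<le> 0"
  proof (rule nonpos_if_decreasing_where_pos[where a = t0 and b = t and d = ?d and d' = ?d'])
    have "continuous_on {t0..} ?d"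
      using u v by (auto simp: nonneg_solution_def intro: continuous_on_diff)
    then show "continuous_on {t0..t} ?d"
      by (rule continuous_on_subset) auto
    show "(?d has_real_derivative ?d' s) (at s)" if "t0 < s" "s < t" for s
      using that u v by (intro DERIV_diff nonneg_solution_has_derivative)
    show "?d' s \<le> 0" if "t0 < s" "s < t" "?d s > 0" for s
    proof -
      have "v s powr lam \<le> u s powr lam"
        using that v \<open>lam \<ge> 0\<close> by (intro powr_mono2) (auto simp: nonneg_solution_def)
      then have "\<beta> * v s powr lam \<le> \<beta> * u s powr lam"
        using \<open>\<beta> \<ge> 0\<close> by (rule mult_left_mono)
      then show ?thesis
        using fg[of s] that by simp
    qed
  qed (use assms in \<open>auto simp: nonneg_solution_def\<close>)
  then show ?thesis
    by simp
qed

corollary nonneg_solution_unique: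
  assumes "\<beta> \<ge> 0" and "lam \<ge> 0"
    and "nonneg_solution \<beta> lam t0 y0 k u" and "nonneg_solution \<beta> lam t0 y0 k v" and "t \<ge> t0"
  shows "u t = v t"
  using nonneg_solution_mono[OF assms(1,2), of t0 y0 k u y0 k v t]
    nonneg_solution_mono[OF assms(1,2), of t0 y0 k v y0 k u t] assms
  by (simp add: order.antisym)

text \<open>
  At the kink \<open>x = 0\<close> the difference quotient is bounded by \<open>\<bar>h\<bar> powr (p - 1)\<close>, which vanishes in the
  limit exactly because \<open>p > 1\<close>.
\<close>

lemma has_real_derivative_pos_part_powr:
  fixes p x :: real
  assumes "p > 1 \<or> x > 0"
  shows "((\<lambda>x. max 0 x powr p) has_real_derivative p * max 0 x powr (p - 1)) (at x)"
proof -
  consider "x > 0" | "x < 0" | "x = 0" "p > 1"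
    using assms by linarith
  then show ?thesis
  proof cases
    case 1
    have "((\<lambda>x. x powr p) has_real_derivative p * x powr (p - 1)) (at x)"
      using 1 by (rule has_real_derivative_powr)
    then have "((\<lambda>x. max 0 x powr p) has_real_derivative p * x powr (p - 1)) (at x)"
      by (rule has_field_derivative_transform_within_open[where S = "{0<..}"]) (use 1 in auto)
    then show ?thesis
      using 1 by simp
  next
    case 2
    have "((\<lambda>x. max 0 x powr p) has_real_derivative 0) (at x)"
      by (rule has_field_derivative_transform_within_open[OF DERIV_const, where S = "{..<0}"])
        (use 2 in auto)
    then show ?thesis
      using 2 by simp
  next
    case 3
    have "((\<lambda>h::real. max 0 h powr p / h) \<longlongrightarrow> 0) (at 0)"
    proof (rule Lim_null_comparison)
      have "norm (max 0 h powr p / h) \<le> \<bar>h\<bar> powr (p - 1)" for h :: real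
        by (cases "h > 0") (simp add: powr_diff, simp)
      then show "\<forall>\<^sub>F h in at (0::real). norm (max 0 h powr p / h) \<le> \<bar>h\<bar> powr (p - 1)"
        by simp
      have "((\<lambda>h::real. \<bar>h\<bar> powr (p - 1)) \<longlongrightarrow> \<bar>0\<bar> powr (p - 1)) (at 0)"
        using \<open>p > 1\<close> by (intro tendsto_powr2 tendsto_intros) auto
      then show "((\<lambda>h::real. \<bar>h\<bar> powr (p - 1)) \<longlongrightarrow> 0) (at 0)"
        by simp
    qed
    then show ?thesis
      using 3 by (simp add: has_field_derivative_iff)
  qed
qed

lemma nonneg_solution_exp:
  assumes "y0 \<ge> 0"
  shows "nonneg_solution \<beta> 1 t0 y0 (\<lambda>_. 0) (\<lambda>t. y0 * exp (- \<beta> * (t - t0)))"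
    (is "nonneg_solution _ _ _ _ _ ?w")
proof -
  have "(?w has_real_derivative - \<beta> * ?w t) (at t)" for t
    by (auto intro!: derivative_eq_intros)
  then have "?w differentiable (at t)" "deriv ?w t = - \<beta> * ?w t" for t
    by (auto simp: real_differentiable_def intro!: DERIV_imp_deriv)
  moreover have "continuous_on {t0..} ?w"
    by (intro continuous_intros)
  ultimately show ?thesis
    using assms by (simp add: nonneg_solution_def)
qed

text \<open>
  With \<open>p = 1 / (1 - lam)\<close> and \<open>c = (lam - 1) * \<beta> * y0 powr (lam - 1)\<close> the slope of the bracket,
  the equation comes down to \<open>p * c = - \<beta> * y0 powr (lam - 1)\<close> and \<open>p - 1 = p * lam\<close>.
\<close>

lemma nonneg_solution_pos_bracket:
  assumes "\<beta> \<ge> 0" and "lam > 0" and "lam \<noteq> 1" and "y0 > 0"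
  shows "nonneg_solution \<beta> lam t0 y0 (\<lambda>_. 0)
    (\<lambda>t. y0 * pos_bracket \<beta> lam t0 y0 t powr (1 / (1 - lam)))"
    (is "nonneg_solution _ _ _ _ _ ?w")
proof -
  define p where "p = 1 / (1 - lam)"
  define c where "c = (lam - 1) * \<beta> * y0 powr (lam - 1)"
  define b where "b t = 1 + c * (t - t0)" for t
  have w: "?w t = y0 * max 0 (b t) powr p" for t
    by (simp add: pos_bracket_def p_def b_def c_def)
  have p_lam: "p - 1 = p * lam"
    using \<open>lam \<noteq> 1\<close> by (simp add: p_def field_simps)
  have "p * c = - \<beta> * y0 powr (lam - 1)"
    using \<open>lam \<noteq> 1\<close> by (simp add: p_def c_def field_simps)
  moreover have "y0 * y0 powr (lam - 1) = y0 powr lam"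
    using \<open>y0 > 0\<close> by (simp add: powr_diff)
  ultimately have y0pc: "y0 * (p * c) = - \<beta> * y0 powr lam"
    by simp
  have w_powr: "?w t powr lam = y0 powr lam * max 0 (b t) powr (p - 1)" for t
    using \<open>y0 > 0\<close> unfolding w by (simp add: powr_mult powr_powr p_lam)
  \<comment> \<open>For \<open>lam > 1\<close> the exponent is negative, but the bracket never falls below \<open>1\<close>.\<close>
  have regular: "p > 1 \<or> b t > 0" if "t \<ge> t0" for t
  proof (cases "lam < 1")
    case True
    then show ?thesis
      using \<open>lam > 0\<close> by (simp add: p_def)
  next
    case False
    then have "c * (t - t0) \<ge> 0"
      using \<open>\<beta> \<ge> 0\<close> that by (simp add: c_def)
    then show ?thesis
      by (simp add: b_def)
  qed
  have deriv: "(?w has_real_derivative - \<beta> * ?w t powr lam) (at t)" if "t \<ge> t0" for t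
  proof -
    have "(b has_real_derivative c) (at t)"
      unfolding b_def by (auto intro!: derivative_eq_intros)
    from DERIV_cmult[OF DERIV_chain2[OF has_real_derivative_pos_part_powr[OF regular[OF that]] this]]
    have "(?w has_real_derivative y0 * (p * max 0 (b t) powr (p - 1) * c)) (at t)"
      by (simp only: w)
    also have "y0 * (p * max 0 (b t) powr (p - 1) * c) = y0 * (p * c) * max 0 (b t) powr (p - 1)"
      by (simp add: mult_ac)
    also have "\<dots> = - \<beta> * ?w t powr lam"
      unfolding y0pc w_powr by (simp add: mult_ac)
    finally show ?thesis .
  qed
  then have "?w differentiable (at t)" "deriv ?w t = - \<beta> * ?w t powr lam" if "t \<ge> t0" for t
    using that by (auto simp: real_differentiable_def intro!: DERIV_imp_deriv)
  moreover have "continuous_on {t0..} ?w"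
    using deriv by (intro continuous_at_imp_continuous_on) (auto intro: DERIV_isCont)
  ultimately show ?thesis
    using \<open>y0 > 0\<close> by (simp add: nonneg_solution_def pos_bracket_def)
qed

theorem lemma3p1:
  fixes \<beta> lam t0 y0 :: real and k y y1 :: "real \<Rightarrow> real"
  assumes "\<beta> > 0" and "lam > 0" and "t0 \<ge> 0" and "y0 > 0"
    and "\<forall>t>t0. k t \<ge> 0"
    and "nonneg_solution \<beta> lam t0 y0 k y"
    and "nonneg_solution \<beta> lam t0 y0 (\<lambda>_. 0) y1"
  shows "\<forall>t\<ge>t0. y t \<ge> y1 t \<and>
    y1 t = (if lam = 1 then y0 * exp (- \<beta> * (t - t0))
            else y0 * pos_bracket \<beta> lam t0 y0 t powr (1 / (1 - lam)))"
proof (intro allI impI conjI)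
  fix t assume "t \<ge> t0"
  show "y1 t \<le> y t"
    by (rule nonneg_solution_mono[OF _ _ assms(7) assms(6)]) (use assms \<open>t \<ge> t0\<close> in auto)
  let ?w = "\<lambda>t. if lam = 1 then y0 * exp (- \<beta> * (t - t0))
            else y0 * pos_bracket \<beta> lam t0 y0 t powr (1 / (1 - lam))"
  have "nonneg_solution \<beta> lam t0 y0 (\<lambda>_. 0) ?w"
    using nonneg_solution_exp[of y0 \<beta> t0] nonneg_solution_pos_bracket[of \<beta> lam y0 t0] assms
    by (cases "lam = 1") simp_all
  then show "y1 t = ?w t"
    using assms \<open>t \<ge> t0\<close> by (intro nonneg_solution_unique[of \<beta> lam t0 y0 "\<lambda>_. 0"]) auto
qed

end
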